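(* Let $(\mathbb{X},\|\cdot\|)$ be a finite-dimensional real normed vector space. Assume that $\|\cdot\|^2$ is $M$-strongly smooth with respect to $\|\cdot\|$. Let $X_1,\dots,X_m$ be independent random vectors in $\mathbb{X}$ such that $\mathbb{E}[X_i]=\mu$ and $\mathbb{E}[\|X_i-\mu\|^2]\le\sigma^2$ for all $i=1,\dots,m$. Then $$\mathbb{E}\Big[\Big\|\frac1m\sum_{i=1}^mX_i-\mu\Big\|^2\Big]\le\frac{M}{2m}\sigma^2.$$
   Context: $\|\cdot\|^2$ is $M$-strongly smooth with respect to $\|\cdot\|$ if $\|x+y\|^2\le\|x\|^2+\langle g_x,y\rangle+\frac M2\|y\|^2$ for all $x,y\in\mathbb{X}$ and all subgradients $g_x\in\partial\|\cdot\|^2(x)$. *)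

theory Defs
  imports "HOL-Probability.Probability"
begin

(* Subgradients are elements of the topological dual X*, and the pairing <g, y> is
   application of the functional g to y. *)
definition subdifferential :: "('a::real_normed_vector \<Rightarrow> real) \<Rightarrow> 'a \<Rightarrow> ('a \<Rightarrow>\<^sub>L real) set" where
  "subdifferential f x = {g. \<forall>z. f z \<ge> f x + blinfun_apply g (z - x)}"

definition strongly_smooth :: "real \<Rightarrow> ('a::real_normed_vector \<Rightarrow> real) \<Rightarrow> bool" where
  "strongly_smooth M f \<longleftrightarrow>
    (\<forall>x y. \<forall>g \<in> subdifferential f x.
      f (x + y) \<le> f x + blinfun_apply g y + M / 2 * (norm y)\<^sup>2)"

end

theory Submission
  imports Defs
begin

text \<open>
  Strong smoothness gives the one-step estimate
  \<open>\<parallel>s + y\<parallel>\<^sup>2 \<le> \<parallel>s\<parallel>\<^sup>2 + g y + M/2 \<parallel>y\<parallel>\<^sup>2\<close> for every subgradient \<open>g\<close> at \<open>s\<close>. Add the centred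
  vectors \<open>X\<^sub>i - \<mu>\<close> one at a time. Each is independent of the partial sum before it and has mean
  zero, so the linear term vanishes in expectation and every summand costs at most
  \<open>M/2 \<sigma>\<^sup>2\<close>. The sum of \<open>m\<close> of them thus has expected squared norm at most \<open>m M/2 \<sigma>\<^sup>2\<close>, and
  rescaling by \<open>1/m\<close> divides this by \<open>m\<^sup>2\<close>.

  Two points need care. A subgradient must exist at every point, since otherwise strong
  smoothness says nothing there: it is \<open>2 \<parallel>x\<parallel>\<close> times a norming functional of \<open>x\<close>, and the
  latter comes from the Hahn-Banach extension step, repeated once for each vector of a finite
  spanning set (\<open>norming_functional_exists\<close>, \<open>subdifferential_norm_sq_nonempty\<close>). And the
  subgradient at the random partial sum \<open>S\<close> would have to be chosen measurably in order to take
  expectations of \<open>g\<^sub>S (Y)\<close>. This is avoided by using Fubini's theorem: for independent \<open>S\<close> and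
  \<open>Y\<close> the inner integral over \<open>Y\<close> is taken with \<open>S = s\<close> fixed, where any single subgradient at
  \<open>s\<close> will do (\<open>expectation_add_indep_le\<close>).
\<close>

section \<open>Existence of subgradients of the squared norm\<close>

lemma linear_separating_functional_exists:
  fixes b :: "'a::real_vector"
  assumes "b \<notin> span S"
  shows "\<exists>\<phi>::'a \<Rightarrow> real. linear \<phi> \<and> \<phi> b = 1 \<and> (\<forall>y\<in>span S. \<phi> y = 0)"
proof -
  obtain A where A: "A \<subseteq> S" "independent A" "S \<subseteq> span A"
    using maximal_independent_subset[of S] by blast
  have span_A: "span A = span S"
    by (meson A(1) A(3) span_mono span_minimal subspace_span subset_antisym)
  then have "independent (insert b A)"
    using A(2) assms by (simp add: independent_insertI)
  then obtain \<phi> :: "'a \<Rightarrow> real"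
    where \<phi>: "linear \<phi>" "\<forall>x\<in>insert b A. \<phi> x = (if x = b then 1 else 0)"
    using linear_independent_extend[of "insert b A" "\<lambda>x. if x = b then 1 else (0::real)"] by blast
  have "b \<notin> A"
    using assms span_A span_base by blast
  then have "\<phi> x = 0" if "x \<in> A" for x
    using \<phi>(2) that by auto
  then have "\<forall>y\<in>span S. \<phi> y = 0"
    using linear_eq_0_on_span[OF \<phi>(1)] span_A by blast
  with \<phi> show ?thesis by auto
qed

text \<open>
  The Hahn-Banach extension by one dimension. The value \<open>c\<close> at \<open>b\<close> has to satisfy
  \<open>g s - \<parallel>s - b\<parallel> \<le> c \<le> \<parallel>t + b\<parallel> - g t\<close> for all \<open>s\<close> and \<open>t\<close> in the old subspace. Such a \<open>c\<close>
  exists because \<open>g (s + t) \<le> \<parallel>s + t\<parallel> \<le> \<parallel>s - b\<parallel> + \<parallel>t + b\<parallel>\<close>. Functionals are kept linear on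
  the whole space and controlled only on the subspace, which avoids partial linear maps.
\<close>

lemma dominated_functional_extension_step:
  fixes g :: "'a::real_normed_vector \<Rightarrow> real"
  assumes g: "linear g" and dom: "\<And>y. y \<in> span S \<Longrightarrow> g y \<le> norm y"
  shows "\<exists>h. linear h \<and> (\<forall>y\<in>span S. h y = g y) \<and> (\<forall>y\<in>span (insert b S). h y \<le> norm y)"
proof (cases "b \<in> span S")
  case True
  then show ?thesis using g dom by (auto simp: span_redundant)
next
  case False
  then obtain \<phi> :: "'a \<Rightarrow> real"
    where \<phi>: "linear \<phi>" "\<phi> b = 1" "\<forall>y\<in>span S. \<phi> y = 0"
    using linear_separating_functional_exists by blast
  define c where "c = (SUP s\<in>span S. g s - norm (s - b))"
  have gap: "g s - norm (s - b) \<le> norm (t + b) - g t" if "s \<in> span S" "t \<in> span S" for s t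
  proof -
    have "g s + g t \<le> norm (s + t)"
      using dom[OF span_add[OF that]] by (simp add: linear_add[OF g])
    also have "\<dots> \<le> norm (s - b) + norm (t + b)"
      using norm_triangle_ineq[of "s - b" "t + b"] by simp
    finally show ?thesis by simp
  qed
  have bdd: "bdd_above ((\<lambda>s. g s - norm (s - b)) ` span S)"
    using gap[OF _ span_zero] by (auto intro!: bdd_aboveI2)
  have lower: "g s - c \<le> norm (s - b)" if "s \<in> span S" for s
    using cSUP_upper[OF that bdd] by (simp add: c_def)
  have upper: "g t + c \<le> norm (t + b)" if "t \<in> span S" for t
  proof -
    have "c \<le> norm (t + b) - g t"
      unfolding c_def using span_zero gap[OF _ that] by (intro cSUP_least) auto
    then show ?thesis by simp
  qed
  define h where "h = (\<lambda>y. g y + (c - g b) * \<phi> y)"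
  have h: "linear h"
    unfolding h_def using g \<phi>(1)
    by (auto simp: linear_iff algebra_simps)
  have h_S: "h y = g y" if "y \<in> span S" for y
    using \<phi>(3) that by (simp add: h_def)
  have h_b: "h b = c"
    by (simp add: h_def \<phi>(2))
  have "h y \<le> norm y" if y_in: "y \<in> span (insert b S)" for y
  proof -
    obtain k where k: "y - k *\<^sub>R b \<in> span S"
      using y_in by (auto simp: span_breakdown_eq)
    define s where "s = y - k *\<^sub>R b"
    have s: "s \<in> span S" and y: "y = s + k *\<^sub>R b"
      using k by (auto simp: s_def)
    have hy: "h y = g s + k * c"
      using h_S[OF s] h_b by (simp add: y linear_add[OF h] linear_scale[OF h])
    consider "k = 0" | "k > 0" | "k < 0" by linarith
    then show ?thesis
    proof cases
      case 1
      then show ?thesis using hy y dom[OF s] by simp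
    next
      case 2
      have "h y = k * (g ((1 / k) *\<^sub>R s) + c)"
        using 2 hy by (simp add: linear_scale[OF g] distrib_left)
      also have "\<dots> \<le> k * norm ((1 / k) *\<^sub>R s + b)"
        using 2 upper[OF span_scale[OF s]] by (intro mult_left_mono) auto
      also have "\<dots> = norm (k *\<^sub>R ((1 / k) *\<^sub>R s + b))"
        using 2 by simp
      also have "\<dots> = norm y"
        using 2 by (simp add: y scaleR_add_right)
      finally show ?thesis .
    next
      case 3
      have "h y = (- k) * (g ((1 / (- k)) *\<^sub>R s) - c)"
        using 3 hy by (simp add: linear_scale[OF g] linear_neg[OF g] right_diff_distrib)
      also have "\<dots> \<le> (- k) * norm ((1 / (- k)) *\<^sub>R s - b)"
        using 3 lower[OF span_scale[OF s, of "1 / (- k)"]] by (intro mult_left_mono) auto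
      also have "\<dots> = norm ((- k) *\<^sub>R ((1 / (- k)) *\<^sub>R s - b))"
        using 3 by (simp only: norm_scaleR)
      also have "\<dots> = norm y"
        using 3 by (simp add: y scaleR_diff_right)
      finally show ?thesis .
    qed
  qed
  with h h_S show ?thesis by blast
qed

lemma norming_functional_exists:
  fixes x :: "'a::real_normed_vector"
  assumes finite_dim: "\<exists>B::'a set. finite B \<and> span B = UNIV"
  shows "\<exists>g::'a \<Rightarrow>\<^sub>L real. blinfun_apply g x = norm x \<and> (\<forall>y. blinfun_apply g y \<le> norm y)"
proof -
  obtain B :: "'a set" where B: "finite B" "span B = UNIV"
    using finite_dim by blast
  from B(1)
  have "\<exists>g. linear g \<and> g x = norm x \<and> (\<forall>y\<in>span (insert x B). g y \<le> norm y)"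
  proof (induction B)
    case empty
    have "\<exists>g::'a \<Rightarrow> real. linear g \<and> g x = norm x"
    proof (cases "x = 0")
      case True
      then show ?thesis by (auto intro!: exI[of _ "\<lambda>_. 0"] module_hom_zero)
    next
      case False
      then obtain \<phi> :: "'a \<Rightarrow> real" where "linear \<phi>" "\<phi> x = 1"
        using linear_separating_functional_exists[of x "{}"] by auto
      then show ?thesis
        by (intro exI[of _ "\<lambda>y. norm x * \<phi> y"]) (auto simp: linear_iff algebra_simps)
    qed
    then obtain g :: "'a \<Rightarrow> real" where g: "linear g" "g x = norm x" by blast
    have "g y \<le> norm y" if "y \<in> span {x}" for y
    proof -
      from that obtain k where "y = k *\<^sub>R x" by (auto simp: span_singleton)
      then show ?thesis
        using g by (simp add: linear_scale mult_right_mono)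
    qed
    with g show ?case by blast
  next
    case (insert b B)
    then obtain g where g: "linear g" "g x = norm x" "\<forall>y\<in>span (insert x B). g y \<le> norm y"
      by blast
    then obtain h where h: "linear h" "\<forall>y\<in>span (insert x B). h y = g y"
        "\<forall>y\<in>span (insert b (insert x B)). h y \<le> norm y"
      using dominated_functional_extension_step[of g "insert x B" b] by blast
    have "h x = norm x"
      using h(2) g(2) by (simp add: span_base)
    with h show ?case by (auto simp: insert_commute)
  qed
  moreover have "span (insert x B) = UNIV"
    using B(2) by (metis span_mono subset_insertI top.extremum_uniqueI)
  ultimately obtain g where g: "linear g" "g x = norm x" "\<And>y. g y \<le> norm y"
    by auto
  have "\<bar>g y\<bar> \<le> norm y" for y
    using g(3)[of y] g(3)[of "- y"] by (simp add: linear_neg[OF g(1)])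
  then have "bounded_linear g"
    by (intro bounded_linear_intro[where K = 1])
      (auto simp: linear_add[OF g(1)] linear_scale[OF g(1)])
  then show ?thesis
    using g by (intro exI[of _ "Blinfun g"]) (simp add: bounded_linear_Blinfun_apply)
qed

text \<open>
  With a norming functional \<open>g\<close> of \<open>x\<close>, the subgradient inequality for \<open>2 \<parallel>x\<parallel> g\<close> reduces to
  \<open>2 \<parallel>x\<parallel> \<parallel>z\<parallel> \<le> \<parallel>x\<parallel>\<^sup>2 + \<parallel>z\<parallel>\<^sup>2\<close>.
\<close>

lemma subdifferential_norm_sq_nonempty:
  fixes x :: "'a::real_normed_vector"
  assumes "\<exists>B::'a set. finite B \<and> span B = UNIV"
  shows "subdifferential (\<lambda>x. (norm x)\<^sup>2) x \<noteq> {}"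
proof -
  obtain g :: "'a \<Rightarrow>\<^sub>L real"
    where g: "blinfun_apply g x = norm x" "\<And>y. blinfun_apply g y \<le> norm y"
    using norming_functional_exists[OF assms] by blast
  have "(norm x)\<^sup>2 + blinfun_apply ((2 * norm x) *\<^sub>R g) (z - x) \<le> (norm z)\<^sup>2" for z
  proof -
    have "(norm x)\<^sup>2 + blinfun_apply ((2 * norm x) *\<^sub>R g) (z - x)
        = 2 * norm x * blinfun_apply g z - (norm x)\<^sup>2"
      by (simp add: scaleR_blinfun.rep_eq blinfun.diff_right g(1) algebra_simps power2_eq_square)
    also have "\<dots> \<le> 2 * norm x * norm z - (norm x)\<^sup>2"
      using g(2) by (simp add: mult_left_mono)
    also have "\<dots> \<le> (norm z)\<^sup>2"
      using sum_squares_bound[of "norm x" "norm z"] by simp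
    finally show ?thesis .
  qed
  then show ?thesis
    by (auto simp: subdifferential_def)
qed

section \<open>Adding independent centred vectors\<close>

lemma (in prob_space) indep_var_sum:
  fixes X :: "'i \<Rightarrow> 'a \<Rightarrow> 'b::{real_normed_vector, second_countable_topology}"
  assumes "i \<notin> I" and indep: "indep_vars (\<lambda>_. borel) X (insert i I)"
  shows "indep_var borel (\<lambda>\<omega>. \<Sum>j\<in>I. X j \<omega>) borel (X i)"
proof -
  have "indep_var
      borel ((\<lambda>f. \<Sum>j\<in>I. f j) \<circ> (\<lambda>\<omega>. restrict (\<lambda>j. X j \<omega>) I))
      borel ((\<lambda>f. f i) \<circ> (\<lambda>\<omega>. restrict (\<lambda>j. X j \<omega>) {i}))"
    using assms(1) by (intro indep_var_compose[OF indep_var_restrict[OF indep]]) auto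
  moreover have "(\<lambda>f. \<Sum>j\<in>I. f j) \<circ> (\<lambda>\<omega>. restrict (\<lambda>j. X j \<omega>) I) = (\<lambda>\<omega>. \<Sum>j\<in>I. X j \<omega>)"
    by (auto intro!: sum.cong)
  moreover have "(\<lambda>f. f i) \<circ> (\<lambda>\<omega>. restrict (\<lambda>j. X j \<omega>) {i}) = X i"
    by auto
  ultimately show ?thesis by simp
qed

text \<open>
  By independence the pair \<open>(S, Y)\<close> has a product law, so the expectation of \<open>f (S + Y)\<close> is an
  iterated integral. For fixed \<open>s\<close> a subgradient \<open>g\<close> of \<open>f\<close> at \<open>s\<close> is one bounded functional,
  whence \<open>g Y\<close> has mean \<open>g 0 = 0\<close>.
\<close>

lemma (in prob_space) expectation_add_indep_le:
  fixes S Y :: "'a \<Rightarrow> 'b::{real_normed_vector, second_countable_topology}"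
  assumes smooth: "strongly_smooth K f"
    and subgradient: "\<And>x. subdifferential f x \<noteq> {}"
    and f[measurable]: "f \<in> borel_measurable borel"
    and indep: "indep_var borel S borel Y"
    and int_S: "integrable M (\<lambda>\<omega>. f (S \<omega>))"
    and int_add: "integrable M (\<lambda>\<omega>. f (S \<omega> + Y \<omega>))"
    and int_Y: "integrable M Y" and centred: "expectation Y = 0"
    and int_sq: "integrable M (\<lambda>\<omega>. (norm (Y \<omega>))\<^sup>2)"
  shows "expectation (\<lambda>\<omega>. f (S \<omega> + Y \<omega>))
    \<le> expectation (\<lambda>\<omega>. f (S \<omega>)) + K / 2 * expectation (\<lambda>\<omega>. (norm (Y \<omega>))\<^sup>2)"
proof -
  have [measurable]: "random_variable borel S" "random_variable borel Y"
    and law: "distr M borel S \<Otimes>\<^sub>M distr M borel Y = distr M (borel \<Otimes>\<^sub>M borel) (\<lambda>\<omega>. (S \<omega>, Y \<omega>))"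
    using indep by (auto simp: indep_var_distribution_eq)
  interpret S: prob_space "distr M borel S" by (rule prob_space_distr) simp
  interpret Y: prob_space "distr M borel Y" by (rule prob_space_distr) simp
  interpret SY: pair_prob_space "distr M borel S" "distr M borel Y" ..
  let ?v = "expectation (\<lambda>\<omega>. (norm (Y \<omega>))\<^sup>2)"
  have int_pair: "integrable (distr M borel S \<Otimes>\<^sub>M distr M borel Y) (\<lambda>p. f (fst p + snd p))"
    using int_add by (simp add: law integrable_distr_eq)
  have inner: "(\<integral>y. f (s + y) \<partial>distr M borel Y) \<le> f s + K / 2 * ?v"
    if "integrable (distr M borel Y) (\<lambda>y. f (s + y))" for s
  proof -
    obtain g where g: "g \<in> subdifferential f s"
      using subgradient by blast
    have int_g: "integrable M (\<lambda>\<omega>. blinfun_apply g (Y \<omega>))"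
      and mean_g: "expectation (\<lambda>\<omega>. blinfun_apply g (Y \<omega>)) = 0"
      using integrable_bounded_linear[OF blinfun.bounded_linear_right int_Y]
        integral_bounded_linear[OF blinfun.bounded_linear_right int_Y] centred by auto
    have "(\<integral>y. f (s + y) \<partial>distr M borel Y) = expectation (\<lambda>\<omega>. f (s + Y \<omega>))"
      by (simp add: integral_distr)
    also have "\<dots> \<le> expectation (\<lambda>\<omega>. f s + blinfun_apply g (Y \<omega>) + K / 2 * (norm (Y \<omega>))\<^sup>2)"
    proof (rule integral_mono)
      show "integrable M (\<lambda>\<omega>. f (s + Y \<omega>))"
        using that by (simp add: integrable_distr_eq)
      show "integrable M (\<lambda>\<omega>. f s + blinfun_apply g (Y \<omega>) + K / 2 * (norm (Y \<omega>))\<^sup>2)"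
        using int_g int_sq by auto
      show "f (s + Y \<omega>) \<le> f s + blinfun_apply g (Y \<omega>) + K / 2 * (norm (Y \<omega>))\<^sup>2" for \<omega>
        using smooth g by (auto simp: strongly_smooth_def)
    qed
    also have "\<dots> = f s + K / 2 * ?v"
      using int_g int_sq mean_g by (simp add: prob_space)
    finally show ?thesis .
  qed
  have "expectation (\<lambda>\<omega>. f (S \<omega> + Y \<omega>))
      = (\<integral>p. f (fst p + snd p) \<partial>(distr M borel S \<Otimes>\<^sub>M distr M borel Y))"
    by (simp add: law integral_distr)
  also have "\<dots> = (\<integral>s. (\<integral>y. f (s + y) \<partial>distr M borel Y) \<partial>distr M borel S)"
    using SY.integral_fst'[OF int_pair] by simp
  also have "\<dots> \<le> (\<integral>s. f s + K / 2 * ?v \<partial>distr M borel S)"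
  proof (rule integral_mono_AE)
    show "integrable (distr M borel S) (\<lambda>s. \<integral>y. f (s + y) \<partial>distr M borel Y)"
      using SY.integrable_fst'[OF int_pair] by simp
    show "integrable (distr M borel S) (\<lambda>s. f s + K / 2 * ?v)"
      using int_S by (simp add: integrable_distr_eq)
    show "AE s in distr M borel S. (\<integral>y. f (s + y) \<partial>distr M borel Y) \<le> f s + K / 2 * ?v"
      using SY.AE_integrable_fst'[OF int_pair] by eventually_elim (rule inner, simp)
  qed
  also have "\<dots> = expectation (\<lambda>\<omega>. f (S \<omega>)) + K / 2 * ?v"
    using int_S by (simp add: integral_distr prob_space)
  finally show ?thesis .
qed

lemma norm_add_sq_le:
  fixes a b :: "'a::real_normed_vector"
  shows "(norm (a + b))\<^sup>2 \<le> 2 * (norm a)\<^sup>2 + 2 * (norm b)\<^sup>2"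
proof -
  have "(norm (a + b))\<^sup>2 \<le> (norm a + norm b)\<^sup>2"
    by (intro power_mono norm_triangle_ineq) simp
  also have "\<dots> \<le> 2 * (norm a)\<^sup>2 + 2 * (norm b)\<^sup>2"
    using sum_squares_bound[of "norm a" "norm b"] by (simp add: power2_sum)
  finally show ?thesis .
qed

text \<open>
  In an inner product space this is Bienayme's identity, with \<open>K = 2\<close> and equality; the induction
  begins at the empty sum, so the first vector costs \<open>K/2\<close> like all the others.
\<close>

lemma (in prob_space) expectation_norm_sq_sum_indep_le:
  fixes Y :: "'i \<Rightarrow> 'a \<Rightarrow> 'b::{real_normed_vector, second_countable_topology}"
  assumes smooth: "strongly_smooth K (\<lambda>x::'b. (norm x)\<^sup>2)"
    and subgradient: "\<And>x::'b. subdifferential (\<lambda>x. (norm x)\<^sup>2) x \<noteq> {}"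
    and "finite I" "indep_vars (\<lambda>_. borel) Y I"
    and "\<And>i. i \<in> I \<Longrightarrow> integrable M (Y i)" "\<And>i. i \<in> I \<Longrightarrow> expectation (Y i) = 0"
    and "\<And>i. i \<in> I \<Longrightarrow> integrable M (\<lambda>\<omega>. (norm (Y i \<omega>))\<^sup>2)"
  shows "integrable M (\<lambda>\<omega>. (norm (\<Sum>i\<in>I. Y i \<omega>))\<^sup>2) \<and>
    expectation (\<lambda>\<omega>. (norm (\<Sum>i\<in>I. Y i \<omega>))\<^sup>2)
      \<le> K / 2 * (\<Sum>i\<in>I. expectation (\<lambda>\<omega>. (norm (Y i \<omega>))\<^sup>2))"
  using assms(3-)
proof (induction I)
  case empty
  show ?case by simp
next
  case (insert i I)
  let ?S = "\<lambda>\<omega>. \<Sum>j\<in>I. Y j \<omega>"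
  have IH: "integrable M (\<lambda>\<omega>. (norm (?S \<omega>))\<^sup>2)"
    "expectation (\<lambda>\<omega>. (norm (?S \<omega>))\<^sup>2) \<le> K / 2 * (\<Sum>j\<in>I. expectation (\<lambda>\<omega>. (norm (Y j \<omega>))\<^sup>2))"
    using insert.IH insert.prems indep_vars_subset[OF insert.prems(1), of I] by auto
  have indep: "indep_var borel ?S borel (Y i)"
    using indep_var_sum[OF insert.hyps(2) insert.prems(1)] .
  then have [measurable]: "random_variable borel ?S" "random_variable borel (Y i)"
    by (auto dest: indep_var_rv1 indep_var_rv2)
  have int_add: "integrable M (\<lambda>\<omega>. (norm (?S \<omega> + Y i \<omega>))\<^sup>2)"
  proof (rule Bochner_Integration.integrable_bound)
    show "integrable M (\<lambda>\<omega>. 2 * (norm (?S \<omega>))\<^sup>2 + 2 * (norm (Y i \<omega>))\<^sup>2)"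
      using IH(1) insert.prems(4) by auto
    show "(\<lambda>\<omega>. (norm (?S \<omega> + Y i \<omega>))\<^sup>2) \<in> borel_measurable M"
      by measurable
  qed (auto simp: norm_add_sq_le)
  have "expectation (\<lambda>\<omega>. (norm (?S \<omega> + Y i \<omega>))\<^sup>2)
      \<le> expectation (\<lambda>\<omega>. (norm (?S \<omega>))\<^sup>2) + K / 2 * expectation (\<lambda>\<omega>. (norm (Y i \<omega>))\<^sup>2)"
    using insert.prems IH(1) int_add indep
    by (intro expectation_add_indep_le[OF smooth subgradient]) auto
  with IH(2) have "expectation (\<lambda>\<omega>. (norm (?S \<omega> + Y i \<omega>))\<^sup>2)
      \<le> K / 2 * (\<Sum>j\<in>insert i I. expectation (\<lambda>\<omega>. (norm (Y j \<omega>))\<^sup>2))"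
    using insert.hyps by (simp add: distrib_left)
  with int_add show ?case
    using insert.hyps by (simp add: add.commute)
qed

theorem lemma3p1:
  fixes P :: "'w measure"
    and X :: "nat \<Rightarrow> 'w \<Rightarrow> 'a::{real_normed_vector, second_countable_topology}"
    and \<mu> :: 'a and M \<sigma> :: real and m :: nat
  assumes finite_dim: "\<exists>B::'a set. finite B \<and> span B = UNIV"
    and M_nonneg: "0 \<le> M"
    and smooth: "strongly_smooth M (\<lambda>x::'a. (norm x)\<^sup>2)"
    and prob: "prob_space P"
    and m_pos: "1 \<le> m"
    and indep: "prob_space.indep_vars P (\<lambda>_. borel) X {1..m}"
    and integrable: "\<And>i. i \<in> {1..m} \<Longrightarrow> integrable P (X i)"
    and mean: "\<And>i. i \<in> {1..m} \<Longrightarrow> prob_space.expectation P (X i) = \<mu>"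
    and integrable_sq: "\<And>i. i \<in> {1..m} \<Longrightarrow> integrable P (\<lambda>\<omega>. (norm (X i \<omega> - \<mu>))\<^sup>2)"
    and variance: "\<And>i. i \<in> {1..m} \<Longrightarrow>
      prob_space.expectation P (\<lambda>\<omega>. (norm (X i \<omega> - \<mu>))\<^sup>2) \<le> \<sigma>\<^sup>2"
  shows "integrable P (\<lambda>\<omega>. (norm ((1 / real m) *\<^sub>R (\<Sum>i=1..m. X i \<omega>) - \<mu>))\<^sup>2) \<and>
    prob_space.expectation P (\<lambda>\<omega>. (norm ((1 / real m) *\<^sub>R (\<Sum>i=1..m. X i \<omega>) - \<mu>))\<^sup>2)
      \<le> M / (2 * real m) * \<sigma>\<^sup>2"
proof -
  interpret prob_space P by fact
  define Y where "Y = (\<lambda>i \<omega>. X i \<omega> - \<mu>)"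
  have "indep_vars (\<lambda>_. borel) Y {1..m}"
    unfolding Y_def by (rule indep_vars_compose2[OF indep]) simp
  moreover have "integrable P (Y i)" "expectation (Y i) = 0"
    if "i \<in> {1..m}" for i
  proof -
    \<comment> \<open>The type is not known to be complete, so constants are integrated through the bounded
      linear map \<open>r \<mapsto> r \<mu>\<close> applied to the real constant 1.\<close>
    have const: "has_bochner_integral P (\<lambda>_. 1 *\<^sub>R \<mu>) (1 *\<^sub>R \<mu>)"
      by (rule has_bochner_integral_bounded_linear[OF bounded_linear_scaleR_left])
        (simp add: has_bochner_integral_iff prob_space)
    have "has_bochner_integral P (X i) \<mu>"
      using integrable[OF that] mean[OF that] by (simp add: has_bochner_integral_iff)
    from has_bochner_integral_diff[OF this const]
    show "integrable P (Y i)" "expectation (Y i) = 0"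
      by (simp_all add: Y_def has_bochner_integral_iff)
  qed
  moreover have "integrable P (\<lambda>\<omega>. (norm (Y i \<omega>))\<^sup>2)" if "i \<in> {1..m}" for i
    using integrable_sq[OF that] by (simp add: Y_def)
  ultimately have int_sum: "integrable P (\<lambda>\<omega>. (norm (\<Sum>i=1..m. Y i \<omega>))\<^sup>2)"
    and "expectation (\<lambda>\<omega>. (norm (\<Sum>i=1..m. Y i \<omega>))\<^sup>2)
      \<le> M / 2 * (\<Sum>i=1..m. expectation (\<lambda>\<omega>. (norm (Y i \<omega>))\<^sup>2))"
    using expectation_norm_sq_sum_indep_le[OF smooth
        subdifferential_norm_sq_nonempty[OF finite_dim], of "{1..m}" Y] by auto
  note this(2)
  also have "M / 2 * (\<Sum>i=1..m. expectation (\<lambda>\<omega>. (norm (Y i \<omega>))\<^sup>2)) \<le> M / 2 * (\<Sum>i=1..m. \<sigma>\<^sup>2)"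
    using variance M_nonneg by (intro mult_left_mono sum_mono) (auto simp: Y_def)
  finally have bound: "expectation (\<lambda>\<omega>. (norm (\<Sum>i=1..m. Y i \<omega>))\<^sup>2) \<le> M / 2 * (real m * \<sigma>\<^sup>2)"
    by simp
  have "(1 / real m) *\<^sub>R (\<Sum>i=1..m. X i \<omega>) - \<mu> = (1 / real m) *\<^sub>R (\<Sum>i=1..m. Y i \<omega>)" for \<omega>
    using m_pos by (simp add: Y_def sum_subtractf scaleR_diff_right sum_constant_scaleR)
  then have rescale: "(norm ((1 / real m) *\<^sub>R (\<Sum>i=1..m. X i \<omega>) - \<mu>))\<^sup>2
      = (norm (\<Sum>i=1..m. Y i \<omega>))\<^sup>2 / (real m)\<^sup>2" for \<omega>
    by (simp add: power_divide)
  have "expectation (\<lambda>\<omega>. (norm (\<Sum>i=1..m. Y i \<omega>))\<^sup>2) / (real m)\<^sup>2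
      \<le> M / 2 * (real m * \<sigma>\<^sup>2) / (real m)\<^sup>2"
    by (intro divide_right_mono bound) simp
  also have "\<dots> = M / (2 * real m) * \<sigma>\<^sup>2"
    using m_pos by (simp add: power2_eq_square)
  finally show ?thesis
    unfolding rescale using int_sum by simp
qed

end
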